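(* There exist tensors $S, T$ such that $S \lesssim T$ and $\Delta(S)\not\subseteq\Delta(T)$.
   Context: For tensors $S\in\mathbb{C}^{a'}\otimes\mathbb{C}^{b'}\otimes\mathbb{C}^{c'}$, $T\in\mathbb{C}^a\otimes\mathbb{C}^b\otimes\mathbb{C}^c$, write $S\le T$ ($S$ is a restriction of $T$) if $S=(A\otimes B\otimes C)T$ for some linear maps $A\colon\mathbb{C}^a\to\mathbb{C}^{a'}$, $B\colon \mathbb{C}^b\to\mathbb{C}^{b'}$, $C\colon\mathbb{C}^c\to\mathbb{C}^{c'}$. Let $\boxtimes$ be the Kronecker product of 3-tensors ($\mathbb{C}^{a}\otimes\mathbb{C}^b\otimes\mathbb{C}^c$ times $\mathbb{C}^{a'}\otimes\mathbb{C}^{b'}\otimes\mathbb{C}^{c'}$ lands in $\mathbb{C}^{aa'}\otimes\mathbb{C}^{bb'}\otimes\mathbb{C}^{cc'}$). Write $S\lesssim T$ ($S$ is an asymptotic restriction of $T$) if there is a function $f(n)$ with $f(n)/n\to0$ such that $S^{\boxtimes n}\le T^{\boxtimes(n+f(n))}$ for all $n$. For nonzero $T$, with flattenings $T_i$ and $\mu_i(T)=T_i^*T_i/\|T\|^2$, $\mathrm{spec}(\mu(T))$ is the triple of non-increasingly ordered eigenvalue vectors of $\mu_1(T),\mu_2(T),\mu_3(T)$, and $\Delta(T) = \{\mathrm{spec}(\mu(R)) : R\in\overline{(\mathrm{GL}_a\times\mathrm{GL}_b\times\mathrm{GL}_c)\cdot T}\setminus\{0\}\}$. Polytopes of tensors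 in different spaces are compared after padding with zeros. *)

theory Defs
  imports
    "HOL-Analysis.Function_Topology"
    "HOL-Library.Multiset"
    "Jordan_Normal_Form.Schur_Decomposition"
begin

(* A tensor in C^a (x) C^b (x) C^c: its three dimensions together with its coordinates, which
   are indexed from 0 and vanish outside the a x b x c box, so that equality of tensors is
   equality in this type. *)

datatype tensor =
  Tensor (dimA: nat) (dimB: nat) (dimC: nat) (coeff: "nat \<Rightarrow> nat \<Rightarrow> nat \<Rightarrow> complex")

definition wf_tensor :: "tensor \<Rightarrow> bool" where
  "wf_tensor T \<longleftrightarrow>
     (\<forall>i j k. coeff T i j k \<noteq> 0 \<longrightarrow> i < dimA T \<and> j < dimB T \<and> k < dimC T)"

definition nonzero_tensor :: "tensor \<Rightarrow> bool" where
  "nonzero_tensor T \<longleftrightarrow> (\<exists>i j k. coeff T i j k \<noteq> 0)"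

(* (A (x) B (x) C) T, for matrices with dim_col A = a, dim_col B = b, dim_col C = c. *)

definition tensor_map :: "complex mat \<Rightarrow> complex mat \<Rightarrow> complex mat \<Rightarrow> tensor \<Rightarrow> tensor" where
  "tensor_map A B C T = Tensor (dim_row A) (dim_row B) (dim_row C)
     (\<lambda>i j k. if i < dim_row A \<and> j < dim_row B \<and> k < dim_row C
        then \<Sum>i'<dimA T. \<Sum>j'<dimB T. \<Sum>k'<dimC T.
               A $$ (i, i') * B $$ (j, j') * C $$ (k, k') * coeff T i' j' k'
        else 0)"

definition restriction :: "tensor \<Rightarrow> tensor \<Rightarrow> bool" where
  "restriction S T \<longleftrightarrow>
     (\<exists>A B C. A \<in> carrier_mat (dimA S) (dimA T) \<and> B \<in> carrier_mat (dimB S) (dimB T) \<and>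
              C \<in> carrier_mat (dimC S) (dimC T) \<and> S = tensor_map A B C T)"

(* The basis vector e_i (x) e_i' of C^a (x) C^a' is identified with e_(i * a' + i') of C^(a * a'). *)

definition kronecker :: "tensor \<Rightarrow> tensor \<Rightarrow> tensor" where
  "kronecker S T = Tensor (dimA S * dimA T) (dimB S * dimB T) (dimC S * dimC T)
     (\<lambda>i j k. coeff S (i div dimA T) (j div dimB T) (k div dimC T) *
              coeff T (i mod dimA T) (j mod dimB T) (k mod dimC T))"

definition unit_tensor :: tensor where
  "unit_tensor = Tensor 1 1 1 (\<lambda>i j k. if i = 0 \<and> j = 0 \<and> k = 0 then 1 else 0)"

primrec kronecker_power :: "tensor \<Rightarrow> nat \<Rightarrow> tensor" where
  "kronecker_power T 0 = unit_tensor"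
| "kronecker_power T (Suc n) = kronecker (kronecker_power T n) T"

definition asymptotic_restriction :: "tensor \<Rightarrow> tensor \<Rightarrow> bool" where
  "asymptotic_restriction S T \<longleftrightarrow>
     (\<exists>f :: nat \<Rightarrow> nat. (\<lambda>n. real (f n) / real n) \<longlonglongrightarrow> 0 \<and>
        (\<forall>n. restriction (kronecker_power S n) (kronecker_power T (n + f n))))"

(* The i-th flattening has its columns indexed by the i-th tensor factor, so that T_i^* T_i acts
   on that factor; rows are pairs of the remaining indices in lexicographic order. *)

definition flattening1 :: "tensor \<Rightarrow> complex mat" where
  "flattening1 T = Matrix.mat (dimB T * dimC T) (dimA T)
     (\<lambda>(r, i). coeff T i (r div dimC T) (r mod dimC T))"

definition flattening2 :: "tensor \<Rightarrow> complex mat" where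
  "flattening2 T = Matrix.mat (dimA T * dimC T) (dimB T)
     (\<lambda>(r, j). coeff T (r div dimC T) j (r mod dimC T))"

definition flattening3 :: "tensor \<Rightarrow> complex mat" where
  "flattening3 T = Matrix.mat (dimA T * dimB T) (dimC T)
     (\<lambda>(r, k). coeff T (r div dimB T) (r mod dimB T) k)"

definition tensor_norm :: "tensor \<Rightarrow> real" where
  "tensor_norm T = sqrt (\<Sum>i<dimA T. \<Sum>j<dimB T. \<Sum>k<dimC T. (cmod (coeff T i j k))\<^sup>2)"

definition moment_of_flattening :: "tensor \<Rightarrow> complex mat \<Rightarrow> complex mat" where
  "moment_of_flattening T M =
     complex_of_real (1 / (tensor_norm T)\<^sup>2) \<cdot>\<^sub>m (mat_adjoint M * M)"

definition moment_map :: "tensor \<Rightarrow> complex mat \<times> complex mat \<times> complex mat" where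
  "moment_map T = (moment_of_flattening T (flattening1 T),
                   moment_of_flattening T (flattening2 T),
                   moment_of_flattening T (flattening3 T))"

(* Eigenvalues with multiplicity in non-increasing order. Only applied to Hermitian matrices,
   for which Re discards nothing. *)

definition ordered_eigenvalues :: "complex mat \<Rightarrow> real list" where
  "ordered_eigenvalues M = rev (sorted_list_of_multiset (image_mset Re (proots (char_poly M))))"

definition spec :: "complex mat \<times> complex mat \<times> complex mat \<Rightarrow> real list \<times> real list \<times> real list"
  where
  "spec = (\<lambda>(M1, M2, M3).
     (ordered_eigenvalues M1, ordered_eigenvalues M2, ordered_eigenvalues M3))"

definition GL :: "nat \<Rightarrow> complex mat set" where
  "GL n = {A \<in> carrier_mat n n. invertible_mat A}"

definition orbit :: "tensor \<Rightarrow> tensor set" where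
  "orbit T = {tensor_map A B C T | A B C. A \<in> GL (dimA T) \<and> B \<in> GL (dimB T) \<and> C \<in> GL (dimC T)}"

(* The closure is taken in the product topology on coordinate functions; on functions supported
   in the fixed finite a x b x c box this is the Euclidean topology, and these functions form a
   closed set. *)

definition orbit_closure :: "tensor \<Rightarrow> tensor set" where
  "orbit_closure T = {R. dimA R = dimA T \<and> dimB R = dimB T \<and> dimC R = dimC T \<and>
                         coeff R \<in> closure (coeff ` orbit T)}"

definition moment_polytope :: "tensor \<Rightarrow> (real list \<times> real list \<times> real list) set" where
  "moment_polytope T = {spec (moment_map R) | R. R \<in> orbit_closure T \<and> nonzero_tensor R}"

(* Padding by infinitely many zeros compares vectors of different lengths exactly as padding
   them to any common length does. *)

definition zero_pad :: "real list \<Rightarrow> nat \<Rightarrow> real" where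
  "zero_pad xs i = (if i < length xs then xs ! i else 0)"

definition zero_pad3 ::
  "real list \<times> real list \<times> real list \<Rightarrow> (nat \<Rightarrow> real) \<times> (nat \<Rightarrow> real) \<times> (nat \<Rightarrow> real)" where
  "zero_pad3 = (\<lambda>(p, q, r). (zero_pad p, zero_pad q, zero_pad r))"

end

theory Submission
  imports Defs
begin

text \<open>
  Take for \<open>T\<close> the Levi-Civita tensor \<open>\<epsilon>\<close> on \<open>\<complex>\<^sup>3\<close> and for \<open>S\<close> the identity matrix of size 3, viewed as
  a tensor whose first dimension is 1. The slices of \<open>\<epsilon>\<close> span the skew-symmetric \<open>3 \<times> 3\<close> matrices,
  which are all singular, so that \<open>S\<close> is not even a degeneration of \<open>\<epsilon>\<close>. But the span of the slices
  of \<open>\<epsilon> \<boxtimes> \<epsilon>\<close> contains an invertible \<open>9 \<times> 9\<close> matrix, namely the sum of the \<open>E\<^sub>a \<otimes> E\<^sub>a\<close> over the three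
  slices \<open>E\<^sub>a\<close>. Hence \<open>S \<boxtimes> S\<close> is a restriction of \<open>\<epsilon> \<boxtimes> \<epsilon>\<close>, which gives \<open>S \<lesssim> \<epsilon>\<close>.

  The separating point is the spectrum of \<open>S\<close> itself: \<open>(1)\<close>, \<open>(1/3, 1/3, 1/3)\<close>, \<open>(1/3, 1/3, 1/3)\<close>.
  If \<open>R\<close> in the orbit closure of \<open>\<epsilon>\<close> has first spectrum \<open>(1, 0, 0)\<close>, its slices are proportional to a
  single matrix. By continuity of the determinant that matrix is singular, so the second spectrum of
  \<open>R\<close> contains 0.
\<close>

section \<open>Restrictions of Kronecker powers\<close>

lemma div_mod_less_iff: "i div b < a \<and> i mod b < b \<longleftrightarrow> i < a * b" for a b i :: nat
  by (cases "b = 0") (auto simp: div_less_iff_less_mult)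

lemma sum_div_mod:
  fixes g :: "nat \<Rightarrow> nat \<Rightarrow> 'a::comm_monoid_add"
  shows "(\<Sum>i<a * b. g (i div b) (i mod b)) = (\<Sum>i<a. \<Sum>j<b. g i j)"
proof (cases "b = 0")
  case False
  show ?thesis
    unfolding sum.cartesian_product
    by (rule sum.reindex_bij_witness[of _ "\<lambda>(i, j). i * b + j" "\<lambda>i. (i div b, i mod b)"])
      (use False in \<open>auto simp: div_mod_less_iff[symmetric]\<close>)
qed simp

lemma sum3_div_mod:
  fixes F G :: "nat \<Rightarrow> nat \<Rightarrow> nat \<Rightarrow> complex"
  shows "(\<Sum>i<a * a'. \<Sum>j<b * b'. \<Sum>k<c * c'.
            F (i div a') (j div b') (k div c') * G (i mod a') (j mod b') (k mod c')) =
         (\<Sum>i<a. \<Sum>j<b. \<Sum>k<c. F i j k) * (\<Sum>i<a'. \<Sum>j<b'. \<Sum>k<c'. G i j k)"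
proof -
  have "(\<Sum>i<a * a'. \<Sum>j<b * b'. \<Sum>k<c * c'.
            F (i div a') (j div b') (k div c') * G (i mod a') (j mod b') (k mod c')) =
        (\<Sum>i<a. \<Sum>i'<a'. \<Sum>j<b. \<Sum>j'<b'. \<Sum>k<c. \<Sum>k'<c'. F i j k * G i' j' k')"
    by (subst sum_div_mod[where g = "\<lambda>k k'. F _ _ k * G _ _ k'"],
        subst sum_div_mod[where g = "\<lambda>j j'. \<Sum>k<c. \<Sum>k'<c'. F _ j k * G _ j' k'"],
        subst sum_div_mod[where g = "\<lambda>i i'. \<Sum>j<b. \<Sum>j'<b'. \<Sum>k<c. \<Sum>k'<c'. F i j k * G i' j' k'"])
      (rule refl)
  also have "\<dots> = (\<Sum>i<a. \<Sum>i'<a'. (\<Sum>j<b. \<Sum>k<c. F i j k) * (\<Sum>j'<b'. \<Sum>k'<c'. G i' j' k'))"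
    by (simp add: sum_product)
  also have "\<dots> = (\<Sum>i<a. \<Sum>j<b. \<Sum>k<c. F i j k) * (\<Sum>i<a'. \<Sum>j<b'. \<Sum>k<c'. G i j k)"
    by (simp add: sum_product)
  finally show ?thesis .
qed

text \<open>The index pairing is that of \<open>kronecker\<close>, so that the mixed-product rule
  \<open>tensor_map_kronecker\<close> is an equality of tensors and not only an isomorphism.\<close>

definition kronecker_mat :: "complex mat \<Rightarrow> complex mat \<Rightarrow> complex mat" where
  "kronecker_mat A B = Matrix.mat (dim_row A * dim_row B) (dim_col A * dim_col B)
     (\<lambda>(i, j). A $$ (i div dim_row B, j div dim_col B) * B $$ (i mod dim_row B, j mod dim_col B))"

lemma coeff_tensor_map_outside:
  "\<not> (i < dim_row A \<and> j < dim_row B \<and> k < dim_row C) \<Longrightarrow> coeff (tensor_map A B C T) i j k = 0"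
  by (auto simp: tensor_map_def)

lemma tensor_map_kronecker:
  assumes "dim_col A = dimA T" "dim_col B = dimB T" "dim_col C = dimC T"
    and "dim_col A' = dimA T'" "dim_col B' = dimB T'" "dim_col C' = dimC T'"
  shows "tensor_map (kronecker_mat A A') (kronecker_mat B B') (kronecker_mat C C') (kronecker T T') =
         kronecker (tensor_map A B C T) (tensor_map A' B' C' T')"
proof -
  have "coeff (tensor_map (kronecker_mat A A') (kronecker_mat B B') (kronecker_mat C C')
           (kronecker T T')) i j k =
        coeff (kronecker (tensor_map A B C T) (tensor_map A' B' C' T')) i j k" for i j k
  proof (cases "i < dim_row A * dim_row A' \<and> j < dim_row B * dim_row B' \<and> k < dim_row C * dim_row C'")
    case True
    then have less: "i div dim_row A' < dim_row A" "i mod dim_row A' < dim_row A'"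
      "j div dim_row B' < dim_row B" "j mod dim_row B' < dim_row B'"
      "k div dim_row C' < dim_row C" "k mod dim_row C' < dim_row C'"
      by (simp_all flip: div_mod_less_iff)
    let ?F = "\<lambda>i' j' k'. A $$ (i div dim_row A', i') * B $$ (j div dim_row B', j') *
      C $$ (k div dim_row C', k') * coeff T i' j' k'"
    let ?G = "\<lambda>i' j' k'. A' $$ (i mod dim_row A', i') * B' $$ (j mod dim_row B', j') *
      C' $$ (k mod dim_row C', k') * coeff T' i' j' k'"
    have "coeff (tensor_map (kronecker_mat A A') (kronecker_mat B B') (kronecker_mat C C')
             (kronecker T T')) i j k =
          (\<Sum>i'<dimA T * dimA T'. \<Sum>j'<dimB T * dimB T'. \<Sum>k'<dimC T * dimC T'.
             ?F (i' div dimA T') (j' div dimB T') (k' div dimC T') *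
             ?G (i' mod dimA T') (j' mod dimB T') (k' mod dimC T'))"
      using True by (auto simp: tensor_map_def kronecker_def kronecker_mat_def assms intro!: sum.cong)
    also have "\<dots> = coeff (kronecker (tensor_map A B C T) (tensor_map A' B' C' T')) i j k"
      using less by (subst sum3_div_mod[where F = ?F and G = ?G]) (simp add: tensor_map_def kronecker_def)
    finally show ?thesis .
  next
    case False
    then have "coeff (kronecker (tensor_map A B C T) (tensor_map A' B' C' T')) i j k = 0"
      unfolding div_mod_less_iff[symmetric] by (auto simp: kronecker_def tensor_map_def)
    moreover have "coeff (tensor_map (kronecker_mat A A') (kronecker_mat B B') (kronecker_mat C C')
        (kronecker T T')) i j k = 0"
      using False by (intro coeff_tensor_map_outside) (auto simp: kronecker_mat_def)
    ultimately show ?thesis by simp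
  qed
  then show ?thesis
    by (intro tensor.expand) (auto simp: fun_eq_iff tensor_map_def kronecker_def kronecker_mat_def)
qed

lemma restriction_kronecker:
  assumes "restriction S T" "restriction S' T'"
  shows "restriction (kronecker S S') (kronecker T T')"
proof -
  obtain A B C where 1: "A \<in> carrier_mat (dimA S) (dimA T)" "B \<in> carrier_mat (dimB S) (dimB T)"
      "C \<in> carrier_mat (dimC S) (dimC T)" "S = tensor_map A B C T"
    using assms(1) unfolding restriction_def by blast
  obtain A' B' C' where 2: "A' \<in> carrier_mat (dimA S') (dimA T')" "B' \<in> carrier_mat (dimB S') (dimB T')"
      "C' \<in> carrier_mat (dimC S') (dimC T')" "S' = tensor_map A' B' C' T'"
    using assms(2) unfolding restriction_def by blast
  have "kronecker S S' =
      tensor_map (kronecker_mat A A') (kronecker_mat B B') (kronecker_mat C C') (kronecker T T')"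
    using 1 2 tensor_map_kronecker[of A T B C A' T' B' C'] by (metis carrier_matD(2))
  moreover have "kronecker_mat A A' \<in> carrier_mat (dimA (kronecker S S')) (dimA (kronecker T T'))"
    "kronecker_mat B B' \<in> carrier_mat (dimB (kronecker S S')) (dimB (kronecker T T'))"
    "kronecker_mat C C' \<in> carrier_mat (dimC (kronecker S S')) (dimC (kronecker T T'))"
    using carrier_matD[OF 1(1)] carrier_matD[OF 1(2)] carrier_matD[OF 1(3)]
      carrier_matD[OF 2(1)] carrier_matD[OF 2(2)] carrier_matD[OF 2(3)]
    by (auto simp: kronecker_mat_def kronecker_def)
  ultimately show ?thesis
    unfolding restriction_def by blast
qed

text \<open>Equality on the nose holds because the pairing of indices is itself associative. It
  regroups two single factors of a power into one square.\<close>

lemma kronecker_assoc: "kronecker (kronecker R S) T = kronecker R (kronecker S T)"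
proof -
  have 1: "i div c div b = i div (b * c)" for i b c :: nat
    by (metis div_mult2_eq mult.commute)
  have 2: "i mod (b * c) div c = i div c mod b" for i b c :: nat
    by (cases "c = 0") (simp_all add: mod_mult2_eq mult.commute[of b c])
  have 3: "i mod (b * c) mod c = i mod c" for i b c :: nat
    by (simp add: mod_mod_cancel)
  show ?thesis
    by (simp add: kronecker_def 1 2 3 mult.assoc fun_eq_iff)
qed

lemma restriction_unit_tensor: "restriction unit_tensor unit_tensor"
  unfolding restriction_def
  by (rule exI[of _ "1\<^sub>m 1"])+ (auto simp: unit_tensor_def tensor_map_def fun_eq_iff)

text \<open>Even powers are powers of \<open>two\<close>. An odd power is an even one times
  \<open>one\<close>, at the price of a single extra copy of \<open>T\<close>, so
  \<open>n mod 2\<close> serves as the sublinear overhead.\<close>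

lemma asymptotic_restrictionI_square:
  assumes one: "restriction S (kronecker T T)"
    and two: "restriction (kronecker S S) (kronecker T T)"
  shows "asymptotic_restriction S T"
proof -
  have even: "restriction (kronecker_power S (2 * m)) (kronecker_power T (2 * m))" for m
  proof (induction m)
    case 0
    then show ?case by (simp add: restriction_unit_tensor)
  next
    case (Suc m)
    then show ?case
      using restriction_kronecker[OF Suc two] by (simp add: kronecker_assoc)
  qed
  have odd: "restriction (kronecker_power S (2 * m + 1)) (kronecker_power T (2 * m + 2))" for m
    using restriction_kronecker[OF even one, of m] by (simp add: kronecker_assoc)
  have "restriction (kronecker_power S n) (kronecker_power T (n + n mod 2))" for n
  proof (cases "even n")
    case True
    then show ?thesis using even[of "n div 2"] by auto
  next
    case False
    then obtain m where "n = 2 * m + 1" by (rule oddE)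
    then show ?thesis using odd[of m] by simp
  qed
  moreover have "(\<lambda>n. real (n mod 2) / real n) \<longlonglongrightarrow> 0"
  proof (rule tendsto_sandwich[OF _ _ tendsto_const lim_1_over_n])
    show "\<forall>\<^sub>F n in sequentially. real (n mod 2) / real n \<le> 1 / real n"
      by (intro always_eventually allI divide_right_mono) auto
  qed auto
  ultimately show ?thesis
    unfolding asymptotic_restriction_def by (intro exI[of _ "\<lambda>n. n mod 2"]) auto
qed

section \<open>Spectra of Gram matrices\<close>

lemma dim_mat_adjoint [simp]: "dim_row (mat_adjoint F) = dim_col F" "dim_col (mat_adjoint F) = dim_row F"
  by (auto simp: mat_adjoint_def mat_of_rows_def)

lemma mat_adjoint_carrier: "F \<in> carrier_mat m n \<Longrightarrow> mat_adjoint F \<in> carrier_mat n m"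
  by auto

lemma index_mat_adjoint [simp]:
  "i < dim_col F \<Longrightarrow> j < dim_row F \<Longrightarrow> mat_adjoint F $$ (i, j) = conjugate (F $$ (j, i))"
  by (auto simp: mat_adjoint_def mat_of_rows_index)

lemma mat_adjoint_cscalar_prod:
  fixes F :: "complex mat"
  assumes F: "F \<in> carrier_mat m n" and w: "w \<in> carrier_vec m" and v: "v \<in> carrier_vec n"
  shows "(mat_adjoint F *\<^sub>v w) \<bullet>c v = w \<bullet>c (F *\<^sub>v v)"
proof -
  have "(mat_adjoint F *\<^sub>v w) \<bullet>c v = (\<Sum>i<n. \<Sum>j<m. cnj (F $$ (j, i)) * w $ j * cnj (v $ i))"
    using F w v
    by (auto simp: scalar_prod_def sum_distrib_right lessThan_atLeast0
        intro!: sum.cong)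
  also have "\<dots> = (\<Sum>j<m. \<Sum>i<n. cnj (F $$ (j, i)) * w $ j * cnj (v $ i))"
    by (rule sum.swap)
  also have "\<dots> = w \<bullet>c (F *\<^sub>v v)"
    using F w v
    by (auto simp: scalar_prod_def sum_distrib_left lessThan_atLeast0 algebra_simps intro!: sum.cong)
  finally show ?thesis .
qed

lemma mat_adjoint_adjoint:
  fixes F :: "complex mat"
  assumes F: "F \<in> carrier_mat m n"
  shows "mat_adjoint (mat_adjoint F) = F"
  using F by (intro eq_matI) auto

lemma gram_mult_vec:
  fixes F :: "complex mat"
  assumes F: "F \<in> carrier_mat m n" and v: "v \<in> carrier_vec n"
  shows "(c \<cdot>\<^sub>m (mat_adjoint F * F)) *\<^sub>v v = c \<cdot>\<^sub>v (mat_adjoint F *\<^sub>v (F *\<^sub>v v))"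
proof -
  have "(c \<cdot>\<^sub>m (mat_adjoint F * F)) *\<^sub>v v = c \<cdot>\<^sub>v ((mat_adjoint F * F) *\<^sub>v v)"
    using F v by (intro eq_vecI) (auto simp: scalar_prod_def mult.assoc simp flip: sum_distrib_left)
  then show ?thesis
    using assoc_mult_mat_vec[OF mat_adjoint_carrier[OF F] F v] by simp
qed

text \<open>The squared norm of \<open>F v\<close> is the inner product of
  \<open>mat_adjoint F (F v)\<close> with \<open>v\<close>.\<close>

lemma mat_adjoint_mult_kernel:
  fixes F :: "complex mat"
  assumes F: "F \<in> carrier_mat m n" and v: "v \<in> carrier_vec n"
    and 0: "mat_adjoint F *\<^sub>v (F *\<^sub>v v) = 0\<^sub>v n"
  shows "F *\<^sub>v v = 0\<^sub>v m"
proof -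
  have Fv: "F *\<^sub>v v \<in> carrier_vec m" using F v by simp
  have "(F *\<^sub>v v) \<bullet>c (F *\<^sub>v v) = 0"
    using mat_adjoint_cscalar_prod[OF F Fv v] 0 v by simp
  then show ?thesis
    using conjugate_square_eq_0_vec[OF Fv] by simp
qed

text \<open>The previous lemma is applied first to the adjoint of \<open>F\<close> at
  \<open>F v\<close>, then to \<open>F\<close> at \<open>v\<close>. This stands in for
  diagonalizability: it rules out a nilpotent part of a Gram matrix.\<close>

lemma gram_square_kernel:
  fixes F :: "complex mat"
  assumes F: "F \<in> carrier_mat m n" and v: "v \<in> carrier_vec n"
    and 0: "F *\<^sub>v (mat_adjoint F *\<^sub>v (F *\<^sub>v v)) = 0\<^sub>v m"
  shows "F *\<^sub>v v = 0\<^sub>v m"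
proof (rule mat_adjoint_mult_kernel[OF F v])
  have Fv: "F *\<^sub>v v \<in> carrier_vec m" using F v by simp
  show "mat_adjoint F *\<^sub>v (F *\<^sub>v v) = 0\<^sub>v n"
    by (rule mat_adjoint_mult_kernel[OF mat_adjoint_carrier[OF F] Fv])
      (simp add: mat_adjoint_adjoint[OF F] 0)
qed

text \<open>The eigenvalue is a Rayleigh quotient: \<open>c\<close> times the squared norm of
  \<open>F v\<close> over that of \<open>v\<close>.\<close>

lemma eigenvalue_gram_real:
  fixes F :: "complex mat"
  assumes F: "F \<in> carrier_mat m n"
    and ev: "eigenvalue (complex_of_real c \<cdot>\<^sub>m (mat_adjoint F * F)) e"
  shows "e \<in> \<real>"
proof -
  have F': "mat_adjoint F \<in> carrier_mat n m" using F by (rule mat_adjoint_carrier)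
  obtain v where v: "v \<in> carrier_vec n" "v \<noteq> 0\<^sub>v n"
    and Gv: "(complex_of_real c \<cdot>\<^sub>m (mat_adjoint F * F)) *\<^sub>v v = e \<cdot>\<^sub>v v"
    using ev F F' unfolding eigenvalue_def eigenvector_def by auto
  have Fv: "F *\<^sub>v v \<in> carrier_vec m" using F v by simp
  have "e * (v \<bullet>c v) = (e \<cdot>\<^sub>v v) \<bullet>c v" using v by simp
  also have "\<dots> = complex_of_real c * ((mat_adjoint F *\<^sub>v (F *\<^sub>v v)) \<bullet>c v)"
    using F F' v by (simp flip: Gv add: gram_mult_vec[OF F])
  also have "\<dots> = complex_of_real c * ((F *\<^sub>v v) \<bullet>c (F *\<^sub>v v))"
    by (simp add: mat_adjoint_cscalar_prod[OF F Fv v(1)])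
  finally have eq: "e * (v \<bullet>c v) = complex_of_real c * ((F *\<^sub>v v) \<bullet>c (F *\<^sub>v v))" .
  have real: "w \<bullet>c w \<in> \<real>" for w :: "complex vec"
    by (auto simp: scalar_prod_def complex_mult_cnj intro!: sum_in_Reals)
  have "v \<bullet>c v \<noteq> 0" using v conjugate_square_eq_0_vec[OF v(1)] by simp
  then have "e = complex_of_real c * ((F *\<^sub>v v) \<bullet>c (F *\<^sub>v v)) / (v \<bullet>c v)"
    using eq by (simp add: field_simps)
  also have "\<dots> \<in> \<real>" using real by auto
  finally show ?thesis .
qed

section \<open>Characteristic polynomials and ordered spectra\<close>

lemma proots_linear_factors: "proots (\<Prod>a\<leftarrow>as. [:- a, 1:]) = mset as" for as :: "complex list"
proof (induction as)
  case (Cons a as)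
  moreover have "(\<Prod>a\<leftarrow>as. [:- a, 1:]) \<noteq> 0" by auto
  ultimately show ?case using proots_mult[of "[:- a, 1:]" "\<Prod>a\<leftarrow>as. [:- a, 1:]"] by simp
qed simp

lemma mset_ordered_eigenvalues:
  assumes "char_poly M = (\<Prod>a\<leftarrow>as. [:- a, 1:])"
  shows "mset (ordered_eigenvalues M) = image_mset Re (mset as)"
  by (simp add: ordered_eigenvalues_def assms proots_linear_factors)

lemma length_ordered_eigenvalues:
  "M \<in> carrier_mat n n \<Longrightarrow> length (ordered_eigenvalues M) = n"
  by (simp add: ordered_eigenvalues_def size_proots_complex degree_monic_char_poly
      flip: size_mset)

text \<open>\<open>ordered_eigenvalues\<close> keeps only real parts; since all roots are real, it
  still determines the polynomial. The order of \<open>es\<close> is left free so that a Schur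
  decomposition can prescribe its diagonal.\<close>

lemma char_poly_gram:
  fixes F :: "complex mat"
  assumes F: "F \<in> carrier_mat m n" and G: "G = complex_of_real c \<cdot>\<^sub>m (mat_adjoint F * F)"
    and es: "mset es = mset (ordered_eigenvalues G)"
  shows "char_poly G = (\<Prod>x\<leftarrow>map complex_of_real es. [:- x, 1:])"
proof -
  have Gc: "G \<in> carrier_mat n n" using F G by auto
  obtain as where as: "char_poly G = (\<Prod>a\<leftarrow>as. [:- a, 1:])"
    using char_poly_factorized[OF Gc] by blast
  have "a \<in> \<real>" if "a \<in> set as" for a
  proof (rule eigenvalue_gram_real[OF F])
    have "poly (char_poly G) a = 0"
      using that unfolding as by (induction as) auto
    then show "eigenvalue (complex_of_real c \<cdot>\<^sub>m (mat_adjoint F * F)) a"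
      using eigenvalue_root_char_poly[OF Gc] G by simp
  qed
  then have "image_mset (\<lambda>a. complex_of_real (Re a)) (mset as) = image_mset (\<lambda>a. a) (mset as)"
    by (intro image_mset_cong) auto
  then have "mset (map complex_of_real es) = mset as"
    using es by (simp add: mset_ordered_eigenvalues[OF as] image_mset.compositionality o_def)
  then have "mset (map (\<lambda>a. [:- a, 1:]) (map complex_of_real es)) = mset (map (\<lambda>a. [:- a, 1:]) as)"
    unfolding mset_map by simp
  then show ?thesis
    unfolding as by (metis prod_mset_prod_list)
qed

text \<open>Triangularize \<open>G = P * B * Q\<close>. All columns of \<open>F * P\<close> but the
  last turn out to be zero, so \<open>F = (F * P) * Q\<close> is the outer product of that last
  column with the last row of \<open>Q\<close>.\<close>

lemma gram_rank_one:
  fixes F :: "complex mat"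
  assumes F: "F \<in> carrier_mat m (Suc n)"
    and G: "G = complex_of_real c \<cdot>\<^sub>m (mat_adjoint F * F)"
    and ev: "ordered_eigenvalues G = 1 # replicate n 0"
  obtains x y where "\<And>r i. r < m \<Longrightarrow> i < Suc n \<Longrightarrow> F $$ (r, i) = x r * y i"
proof -
  \<comment> \<open>The Schur diagonal follows this order. With 1 last, the leading \<open>n\<close>
    by \<open>n\<close> block of \<open>B\<close> is strictly upper triangular.\<close>
  let ?es = "map complex_of_real (replicate n 0 @ [1])"
  have F': "mat_adjoint F \<in> carrier_mat (Suc n) m" using F by (rule mat_adjoint_carrier)
  then have Gc: "G \<in> carrier_mat (Suc n) (Suc n)" using F G by auto
  \<comment> \<open>\<open>c\<close> is cancelled below. The eigenvalue 1 excludes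
    \<open>c = 0\<close>, the factor that \<open>moment_of_flattening\<close> yields for a zero
    tensor because 1/0 = 0.\<close>
  have "c \<noteq> 0"
  proof
    assume "c = 0"
    then have "G = 0\<^sub>m (Suc n) (Suc n)"
      using F unfolding G by (intro eq_matI) auto
    then have "upper_triangular G" "diag_mat G = replicate (Suc n) 0"
      by (auto simp: diag_mat_def list_eq_iff_nth_eq simp del: upt_Suc replicate_Suc)
    then have "mset (ordered_eigenvalues G) = image_mset Re (mset (replicate (Suc n) 0))"
      using mset_ordered_eigenvalues[OF char_poly_upper_triangular[OF Gc]] by (simp only:)
    then have "1 \<in># image_mset Re (mset (replicate (Suc n) 0))" unfolding ev by (metis list.set_intros(1) set_mset_mset)
    then show False by (auto simp: in_replicate_mset simp del: replicate_Suc split: if_splits)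
  qed
  have "char_poly G = (\<Prod>x\<leftarrow>?es. [:- x, 1:])"
    by (rule char_poly_gram[OF F G]) (simp add: ev)
  moreover obtain B P Q where "schur_decomposition G ?es = (B, P, Q)"
    by (cases "schur_decomposition G ?es")
  ultimately have sim: "similar_mat_wit G B P Q" and ut: "upper_triangular B" and diag: "diag_mat B = ?es"
    using schur_decomposition[OF Gc] by blast+
  have PQ: "P * Q = 1\<^sub>m (Suc n)" "Q * P = 1\<^sub>m (Suc n)" "G = P * B * Q"
    and B: "B \<in> carrier_mat (Suc n) (Suc n)" and P: "P \<in> carrier_mat (Suc n) (Suc n)"
    and Q: "Q \<in> carrier_mat (Suc n) (Suc n)"
    using similar_mat_witD2[OF Gc sim] by blast+
  have GP: "G * P = P * B"
    unfolding PQ(3) assoc_mult_mat[OF mult_carrier_mat[OF P B] Q P] PQ(2)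
    by (rule right_mult_one_mat[OF mult_carrier_mat[OF P B]])
  define H where "H = F * P"
  have H: "H \<in> carrier_mat m (Suc n)" using F P by (simp add: H_def)
  have colH: "col H k = F *\<^sub>v col P k" if "k < Suc n" for k
    unfolding H_def by (rule col_mult2[OF F P that])
  have diag0: "B $$ (k, k) = 0" if "k < n" for k
  proof -
    have "B $$ (k, k) = diag_mat B ! k" using B that by (simp add: diag_mat_def del: upt_Suc)
    then show ?thesis using diag that by (simp add: nth_append)
  qed
  \<comment> \<open>The columns of \<open>P\<close> before the last span the kernel of \<open>F\<close>: on that span \<open>G\<close> is
    nilpotent, and a Gram matrix has no nilpotent part.\<close>
  have zero: "col H k = 0\<^sub>v m" if "k < n" for k
    using that
  proof (induction k rule: less_induct)
    case (less k)
    have colP: "col P k \<in> carrier_vec (Suc n)" using P by (metis carrier_matD(1) col_dim)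
    have colB: "col B k \<in> carrier_vec (Suc n)" using B by (metis carrier_matD(1) col_dim)
    have k: "k < Suc n" using less.prems by simp
    have "F *\<^sub>v (G *\<^sub>v col P k) = F *\<^sub>v (P *\<^sub>v col B k)"
      using GP by (simp only: flip: col_mult2[OF Gc P k] col_mult2[OF P B k])
    also have "\<dots> = H *\<^sub>v col B k"
      unfolding H_def by (rule assoc_mult_mat_vec[OF F P colB, symmetric])
    also have "\<dots> = 0\<^sub>v m"
    proof (rule eq_vecI)
      fix r assume "r < dim_vec (0\<^sub>v m)"
      then have r: "r < m" by simp
      \<comment> \<open>The three ranges of \<open>j\<close> use the induction hypothesis, the zero
        diagonal and triangularity, in this order.\<close>
      have "H $$ (r, j) * B $$ (j, k) = 0" if j: "j < Suc n" for j
      proof (cases j k rule: linorder_cases)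
        case less
        then have "H $$ (r, j) = col H j $ r" using H r j by simp
        then show ?thesis using less.IH less less.prems r by simp
      next
        case equal
        then show ?thesis using diag0 less.prems by simp
      next
        case greater
        then show ?thesis using ut B j by (simp add: upper_triangular_def)
      qed
      then show "(H *\<^sub>v col B k) $ r = 0\<^sub>v m $ r"
        using H B r less.prems by (auto simp: scalar_prod_def simp del: sum.op_ivl_Suc intro!: sum.neutral)
    qed (use H in simp)
    finally have "F *\<^sub>v (G *\<^sub>v col P k) = 0\<^sub>v m" .
    moreover have "F *\<^sub>v (G *\<^sub>v col P k) =
        complex_of_real c \<cdot>\<^sub>v (F *\<^sub>v (mat_adjoint F *\<^sub>v (F *\<^sub>v col P k)))"
      unfolding G gram_mult_vec[OF F colP]
      by (intro mult_mat_vec[OF F] mult_mat_vec_carrier[OF F'] mult_mat_vec_carrier[OF F] colP)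
    ultimately have scaled: "complex_of_real c \<cdot>\<^sub>v (F *\<^sub>v (mat_adjoint F *\<^sub>v (F *\<^sub>v col P k))) = 0\<^sub>v m"
      by simp
    have "F *\<^sub>v (mat_adjoint F *\<^sub>v (F *\<^sub>v col P k)) = 0\<^sub>v m" (is "?w = _")
    proof (rule eq_vecI)
      fix r assume "r < dim_vec (0\<^sub>v m :: complex vec)"
      then have r: "r < m" by simp
      have "complex_of_real c * ?w $ r = (complex_of_real c \<cdot>\<^sub>v ?w) $ r"
        using F r by (intro index_smult_vec(1)[symmetric]) simp
      also have "\<dots> = 0" unfolding scaled using r by simp
      finally show "?w $ r = 0\<^sub>v m $ r" using \<open>c \<noteq> 0\<close> r by simp
    qed (use F in simp)
    then show ?case
      using gram_square_kernel[OF F colP] colH less.prems by simp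
  qed
  have FHQ: "F = H * Q"
    unfolding H_def assoc_mult_mat[OF F P Q] PQ(1) by (rule right_mult_one_mat[OF F, symmetric])
  have "F $$ (r, i) = H $$ (r, n) * Q $$ (n, i)" if "r < m" "i < Suc n" for r i
  proof -
    have "H $$ (r, k) = 0" if "k < n" for k
    proof -
      have "H $$ (r, k) = col H k $ r" using H \<open>r < m\<close> that by simp
      then show ?thesis using zero[OF that] \<open>r < m\<close> by simp
    qed
    then have "(\<Sum>k = 0..<n. H $$ (r, k) * Q $$ (k, i)) = 0"
      by (intro sum.neutral) simp
    moreover have "(H * Q) $$ (r, i) = (\<Sum>k = 0..<Suc n. H $$ (r, k) * Q $$ (k, i))"
      using H Q that by (simp add: scalar_prod_def)
    ultimately show ?thesis
      unfolding FHQ by simp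
  qed
  then show thesis
    by (rule that[of "\<lambda>r. H $$ (r, n)" "\<lambda>i. Q $$ (n, i)"])
qed

lemma zero_mem_ordered_eigenvalues:
  fixes F :: "complex mat"
  assumes F: "F \<in> carrier_mat m n" and v: "v \<in> carrier_vec n" "v \<noteq> 0\<^sub>v n" and Fv: "F *\<^sub>v v = 0\<^sub>v m"
  shows "0 \<in> set (ordered_eigenvalues (c \<cdot>\<^sub>m (mat_adjoint F * F)))"
proof -
  let ?G = "c \<cdot>\<^sub>m (mat_adjoint F * F)"
  have F': "mat_adjoint F \<in> carrier_mat n m" using F by (rule mat_adjoint_carrier)
  have G: "?G \<in> carrier_mat n n" using F F' by auto
  have "?G *\<^sub>v v = 0 \<cdot>\<^sub>v v"
    using F v by (intro eq_vecI) (auto simp: gram_mult_vec[OF F v(1)] Fv scalar_prod_def)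
  then have "eigenvalue ?G 0"
    using G v unfolding eigenvalue_def eigenvector_def by (metis carrier_matD(1))
  then have "poly (char_poly ?G) 0 = 0"
    using eigenvalue_root_char_poly[OF G] by simp
  moreover have "char_poly ?G \<noteq> 0"
    using degree_monic_char_poly[OF G] by auto
  ultimately have "0 \<in># proots (char_poly ?G)"
    by simp
  then have "Re 0 \<in># image_mset Re (proots (char_poly ?G))"
    unfolding set_image_mset by (rule imageI)
  then show ?thesis
    by (simp add: ordered_eigenvalues_def flip: set_mset_mset)
qed

text \<open>Recovers a spectrum as a list once its length is known, since polytopes are compared
  only after padding.\<close>

lemma zero_pad_eqD:
  assumes "zero_pad xs = zero_pad ys" "length ys \<le> length xs"
  shows "xs = ys @ replicate (length xs - length ys) 0"
proof (rule nth_equalityI)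
  fix i assume "i < length xs"
  then show "xs ! i = (ys @ replicate (length xs - length ys) 0) ! i"
    using fun_cong[OF assms(1), of i] by (auto simp: zero_pad_def nth_append split: if_splits)
qed (use assms(2) in simp)

section \<open>The Levi-Civita tensor\<close>

text \<open>Half the Vandermonde product of \<open>i\<close>, \<open>j\<close>, \<open>k\<close>:
  the sign of the permutation, and 0 if two indices agree. The differences are complex, so nothing
  is truncated.\<close>

definition levi_civita :: tensor where
  "levi_civita = Tensor 3 3 3 (\<lambda>i j k. if i < 3 \<and> j < 3 \<and> k < 3
     then (of_nat j - of_nat i) * (of_nat k - of_nat i) * (of_nat k - of_nat j) / 2 else 0)"

definition identity_slice :: tensor where
  "identity_slice = Tensor 1 3 3 (\<lambda>i j k. if i = 0 \<and> j = k \<and> j < 3 then 1 else 0)"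

section \<open>An invertible matrix in the slice span of the Kronecker square\<close>

lemma less_9_cases:
  assumes "(j::nat) < 9"
  obtains "j = 0" | "j = 1" | "j = 2" | "j = 3" | "j = 4" | "j = 5" | "j = 6" | "j = 7" | "j = 8"
  using assms by linarith

lemma sum_lessThan_9: "sum f {..<9::nat} = f 0 + f 1 + f 2 + f 3 + f 4 + f 5 + f 6 + f 7 + f 8"
  for f :: "nat \<Rightarrow> 'a::comm_monoid_add"
  by (simp add: numeral_eq_Suc add_ac)

text \<open>Writing \<open>j = 3 * j1 + j2\<close> and \<open>k = 3 * k1 + k2\<close>, the next definition is the right-hand side of
  \<open>\<Sum>a. \<epsilon> a j1 k1 * \<epsilon> a j2 k2 = \<delta> j1 j2 * \<delta> k1 k2 - \<delta> j1 k2 * \<delta> k1 j2\<close>. As an operator on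
  \<open>3 \<times> 3\<close> matrices it is \<open>X \<mapsto> tr X * I - X\<^sup>T\<close>, with inverse \<open>X \<mapsto> tr X / 2 * I - X\<^sup>T\<close>.\<close>

definition trace_contraction :: "nat \<Rightarrow> nat \<Rightarrow> complex" where
  "trace_contraction j k = of_bool (j div 3 = j mod 3 \<and> k div 3 = k mod 3) -
     of_bool (j div 3 = k mod 3 \<and> k div 3 = j mod 3)"

text \<open>The weight selects the diagonal indices \<open>i = 3 * a + a\<close> of the first
  factor, which sums the products of each slice with itself. The identity is checked entry by
  entry.\<close>

lemma levi_civita_contraction:
  assumes "j < 9" "k < 9"
  shows "(\<Sum>i<9. of_bool (i div 3 = i mod 3) * coeff (kronecker levi_civita levi_civita) i j k) =
    trace_contraction j k"
  using assms(1) by (cases rule: less_9_cases; use assms(2) in \<open>cases rule: less_9_cases\<close>)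
    (simp_all add: sum_lessThan_9 kronecker_def levi_civita_def trace_contraction_def)

definition trace_contraction_inverse :: "nat \<Rightarrow> nat \<Rightarrow> complex" where
  "trace_contraction_inverse j k = of_bool (j div 3 = j mod 3 \<and> k div 3 = k mod 3) / 2 -
     of_bool (j div 3 = k mod 3 \<and> k div 3 = j mod 3)"

text \<open>Both matrices are symmetric, so summing over the second index of each is the matrix
  product. This is the form in which a map on the third factor acts.\<close>

lemma trace_contraction_inverse:
  assumes "j < 9" "k < 9"
  shows "(\<Sum>l<9. trace_contraction j l * trace_contraction_inverse k l) = of_bool (j = k)"
  using assms(1) by (cases rule: less_9_cases; use assms(2) in \<open>cases rule: less_9_cases\<close>)
    (simp_all add: sum_lessThan_9 trace_contraction_def trace_contraction_inverse_def)

text \<open>\<open>A\<close> contracts the first factor to produce \<open>trace_contraction\<close>,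
  \<open>C\<close> consists of the first \<open>n\<close> rows of its inverse, and \<open>B\<close>
  keeps the first \<open>n\<close> coordinates. The values 3 and 9 of \<open>n\<close> give the two
  hypotheses of \<open>asymptotic_restrictionI_square\<close>.\<close>

lemma restriction_levi_civita_square:
  assumes dims: "dimA S = 1" "dimB S = n" "dimC S = n"
    and coeff_S: "\<And>i j k. coeff S i j k = of_bool (i = 0 \<and> j = k \<and> j < n)"
    and n: "n \<le> 9"
  shows "restriction S (kronecker levi_civita levi_civita)"
proof -
  let ?T = "kronecker levi_civita levi_civita"
  define A :: "complex mat" where "A = Matrix.mat 1 9 (\<lambda>(_, i). of_bool (i div 3 = i mod 3))"
  define B :: "complex mat" where "B = Matrix.mat n 9 (\<lambda>(j, j'). of_bool (j' = j))"
  define C where "C = Matrix.mat n 9 (\<lambda>(k, k'). trace_contraction_inverse k k')"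
  have dim: "dimA ?T = 9" "dimB ?T = 9" "dimC ?T = 9"
    by (simp_all add: kronecker_def levi_civita_def)
  have "coeff (tensor_map A B C ?T) 0 j k = of_bool (j = k)" if "j < n" "k < n" for j k
  proof -
    have "coeff (tensor_map A B C ?T) 0 j k = (\<Sum>i'<9. \<Sum>j'<9. \<Sum>k'<9. of_bool (i' div 3 = i' mod 3) *
        of_bool (j' = j) * trace_contraction_inverse k k' * coeff ?T i' j' k')"
      using that by (simp add: tensor_map_def dim A_def B_def C_def)
    also have "\<dots> = (\<Sum>i'<9. \<Sum>j'<9. of_bool (j' = j) * (\<Sum>k'<9. of_bool (i' div 3 = i' mod 3) *
        trace_contraction_inverse k k' * coeff ?T i' j' k'))"
      by (simp add: sum_distrib_left mult_ac)
    also have "\<dots> = (\<Sum>i'<9. \<Sum>k'<9. of_bool (i' div 3 = i' mod 3) *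
        trace_contraction_inverse k k' * coeff ?T i' j k')"
      using n \<open>j < n\<close> by (simp add: of_bool_def if_distrib[of "\<lambda>x. x * _"] cong: if_cong)
    also have "\<dots> = (\<Sum>k'<9. \<Sum>i'<9. of_bool (i' div 3 = i' mod 3) *
        trace_contraction_inverse k k' * coeff ?T i' j k')"
      by (rule sum.swap)
    also have "\<dots> = (\<Sum>k'<9. trace_contraction j k' * trace_contraction_inverse k k')"
      using n \<open>j < n\<close>
      by (intro sum.cong refl, subst levi_civita_contraction[symmetric])
        (simp_all only: sum_distrib_left sum_distrib_right mult_ac lessThan_iff)
    also have "\<dots> = of_bool (j = k)"
      using n that by (simp add: trace_contraction_inverse)
    finally show ?thesis .
  qed
  moreover have "coeff (tensor_map A B C ?T) i j k = 0" if "\<not> (i = 0 \<and> j < n \<and> k < n)" for i j k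
    using that by (intro coeff_tensor_map_outside) (auto simp: A_def B_def C_def)
  ultimately have "coeff S i j k = coeff (tensor_map A B C ?T) i j k" for i j k
    unfolding coeff_S by (cases "i = 0 \<and> j < n \<and> k < n") auto
  then have "S = tensor_map A B C ?T"
    by (intro tensor.expand) (auto simp: fun_eq_iff dims tensor_map_def A_def B_def C_def)
  moreover have "A \<in> carrier_mat (dimA S) (dimA ?T)" "B \<in> carrier_mat (dimB S) (dimB ?T)"
    "C \<in> carrier_mat (dimC S) (dimC ?T)"
    by (simp_all add: dims dim A_def B_def C_def)
  ultimately show ?thesis
    unfolding restriction_def by blast
qed

lemma asymptotic_restriction_identity_slice: "asymptotic_restriction identity_slice levi_civita"
proof (rule asymptotic_restrictionI_square)
  show "restriction identity_slice (kronecker levi_civita levi_civita)"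
    by (rule restriction_levi_civita_square[where n = 3]) (auto simp: identity_slice_def)
  \<comment> \<open>The Kronecker square of the 3 by 3 identity is the 9 by 9 identity, since
    quotient and remainder determine the index.\<close>
  have "j div 3 = k div 3 \<and> j div 3 < 3 \<and> j mod 3 = k mod 3 \<longleftrightarrow> j = k \<and> j < 9" for j k :: nat
    using div_less_iff_less_mult[of 3 j 3] by (simp, metis div_mult_mod_eq)
  then show "restriction (kronecker identity_slice identity_slice) (kronecker levi_civita levi_civita)"
    by (intro restriction_levi_civita_square[where n = 9])
      (auto simp: identity_slice_def kronecker_def)
qed

section \<open>Singular slices throughout the orbit closure\<close>

lemma det_skew_symmetric:
  fixes X :: "complex mat"
  assumes X: "X \<in> carrier_mat n n" and "odd n" and skew: "transpose_mat X = (- 1) \<cdot>\<^sub>m X"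
  shows "Determinant.det X = 0"
proof -
  have "Determinant.det X = (- 1) ^ n * Determinant.det X"
    using det_transpose[OF X] X by (simp add: skew)
  then show ?thesis using \<open>odd n\<close> by simp
qed

text \<open>A slice of \<open>R\<close> is a combination \<open>X\<close> of skew slices, multiplied
  on both sides by matrices; \<open>X\<close> is skew of odd size, hence singular.\<close>

lemma det_slice_orbit_levi_civita:
  assumes "R \<in> orbit levi_civita" "i < 3"
  shows "Determinant.det (Matrix.mat 3 3 (\<lambda>(k, j). coeff R i j k)) = 0"
proof -
  obtain A B C where A: "A \<in> carrier_mat 3 3" and B: "B \<in> carrier_mat 3 3" and C: "C \<in> carrier_mat 3 3"
    and R: "R = tensor_map A B C levi_civita"
    using assms(1) by (auto simp: orbit_def GL_def levi_civita_def)
  define X where "X = Matrix.mat 3 3 (\<lambda>(k, j). \<Sum>i'<3. A $$ (i, i') * coeff levi_civita i' j k)"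
  have X: "X \<in> carrier_mat 3 3" by (simp add: X_def)
  have "transpose_mat X = (- 1) \<cdot>\<^sub>m X"
    by (intro eq_matI)
      (auto simp: X_def levi_civita_def simp flip: sum_negf intro!: sum.cong, simp add: field_simps)
  then have "Determinant.det X = 0"
    by (rule det_skew_symmetric[OF X, rotated]) simp
  moreover have "Matrix.mat 3 3 (\<lambda>(k, j). coeff R i j k) = C * X * transpose_mat B"
  proof (rule eq_matI)
    fix k j assume "k < dim_row (C * X * transpose_mat B)" "j < dim_col (C * X * transpose_mat B)"
    then have kj: "k < 3" "j < 3" using B C by auto
    have "coeff R i j k = (\<Sum>i'<3. \<Sum>j'<3. \<Sum>k'<3.
        A $$ (i, i') * B $$ (j, j') * C $$ (k, k') * coeff levi_civita i' j' k')"
      using A B C kj assms(2) by (simp add: R tensor_map_def levi_civita_def)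
    also have "\<dots> = (\<Sum>j'<3. \<Sum>i'<3. \<Sum>k'<3.
        A $$ (i, i') * B $$ (j, j') * C $$ (k, k') * coeff levi_civita i' j' k')"
      by (rule sum.swap)
    also have "\<dots> = (\<Sum>j'<3. \<Sum>k'<3. \<Sum>i'<3.
        A $$ (i, i') * B $$ (j, j') * C $$ (k, k') * coeff levi_civita i' j' k')"
      by (intro sum.cong refl sum.swap)
    also have "\<dots> = (\<Sum>j'<3. (\<Sum>k'<3. C $$ (k, k') * X $$ (k', j')) * B $$ (j, j'))"
      by (simp add: X_def sum_distrib_left sum_distrib_right mult_ac)
    also have "\<dots> = (C * X * transpose_mat B) $$ (k, j)"
      using B C X kj by (simp add: scalar_prod_def lessThan_atLeast0 del: assoc_mult_mat)
    finally show "Matrix.mat 3 3 (\<lambda>(k, j). coeff R i j k) $$ (k, j) = (C * X * transpose_mat B) $$ (k, j)"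
      using kj by simp
  qed (use B C in auto)
  ultimately show ?thesis
    using B C X det_mult[of "C * X" 3 "transpose_mat B"] det_mult[OF C X] by simp
qed

text \<open>The determinant of a slice is a polynomial in finitely many coordinates, so its zero set
  is closed in the product topology and contains the closure of the orbit.\<close>

lemma det_slice_orbit_closure_levi_civita:
  assumes "R \<in> orbit_closure levi_civita" "i < 3"
  shows "Determinant.det (Matrix.mat 3 3 (\<lambda>(k, j). coeff R i j k)) = 0"
proof -
  define D where "D c = Determinant.det (Matrix.mat 3 3 (\<lambda>(k, j). c i j k))"
    for c :: "nat \<Rightarrow> nat \<Rightarrow> nat \<Rightarrow> complex"
  have "continuous_on UNIV (\<lambda>c :: nat \<Rightarrow> nat \<Rightarrow> nat \<Rightarrow> complex. c i j k)" for j k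
    by (rule continuous_on_product_then_coordinatewise[OF
          continuous_on_product_then_coordinatewise[OF continuous_on_product_coordinates]])
  then have "continuous_on UNIV D"
    unfolding D_def by (subst det_def'[OF mat_carrier]) (auto intro!: continuous_intros)
  then have "closed {c. D c = 0}"
    by (intro closed_Collect_eq continuous_on_const)
  moreover have "coeff ` orbit levi_civita \<subseteq> {c. D c = 0}"
    using det_slice_orbit_levi_civita assms(2) by (auto simp: D_def)
  ultimately have "closure (coeff ` orbit levi_civita) \<subseteq> {c. D c = 0}"
    by (intro closure_minimal)
  then show ?thesis
    using assms(1) by (auto simp: orbit_closure_def D_def)
qed

text \<open>The first flattening has rank one, so all slices are multiples of one singular matrix. A
  common kernel vector of the slices lies in the kernel of the second flattening.\<close>

lemma singular_moment_orbit_closure_levi_civita: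
  assumes R: "R \<in> orbit_closure levi_civita"
    and ev: "ordered_eigenvalues (moment_of_flattening R (flattening1 R)) = [1, 0, 0]"
  shows "0 \<in> set (ordered_eigenvalues (moment_of_flattening R (flattening2 R)))"
proof -
  have dim: "dimA R = 3" "dimB R = 3" "dimC R = 3"
    using R by (auto simp: orbit_closure_def levi_civita_def)
  have F1: "flattening1 R \<in> carrier_mat 9 (Suc 2)" and F2: "flattening2 R \<in> carrier_mat 9 3"
    by (auto simp: flattening1_def flattening2_def dim)
  have "ordered_eigenvalues (moment_of_flattening R (flattening1 R)) = 1 # replicate 2 0"
    by (simp add: ev numeral_2_eq_2)
  from gram_rank_one[OF F1 moment_of_flattening_def this] obtain x y
    where xy: "\<And>r i. r < 9 \<Longrightarrow> i < Suc 2 \<Longrightarrow> flattening1 R $$ (r, i) = x r * y i"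
    by metis
  have coeff_R: "coeff R i j k = x (j * 3 + k) * y i" if "i < 3" "j < 3" "k < 3" for i j k
    using xy[of "j * 3 + k" i] that by (simp add: flattening1_def dim)
  \<comment> \<open>A slice with nonzero factor \<open>y i\<close> is chosen if there is one.
    Otherwise all slices vanish and any \<open>i\<close> works.\<close>
  obtain i where i: "i < 3" "y i \<noteq> 0 \<or> (\<forall>i'<3. y i' = 0)"
    by (metis zero_less_numeral)
  \<comment> \<open>Columns are indexed by \<open>j\<close>, so that a kernel vector lives in the
    second tensor factor, the domain of \<open>flattening2\<close>.\<close>
  let ?M = "Matrix.mat 3 3 (\<lambda>(k, j). coeff R i j k)"
  have "Determinant.det ?M = 0"
    by (rule det_slice_orbit_closure_levi_civita[OF R i(1)])
  then obtain v where v: "v \<in> carrier_vec 3" "v \<noteq> 0\<^sub>v 3" and Mv: "?M *\<^sub>v v = 0\<^sub>v 3"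
    using det_0_iff_vec_prod_zero[OF mat_carrier] by blast
  have slice: "y i * (\<Sum>j<3. x (j * 3 + k) * v $ j) = 0" if "k < 3" for k
  proof -
    have "(?M *\<^sub>v v) $ k = y i * (\<Sum>j<3. x (j * 3 + k) * v $ j)"
      using v i(1) that
      by (auto simp: scalar_prod_def coeff_R sum_distrib_left mult_ac lessThan_atLeast0 intro!: sum.cong)
    then show ?thesis using Mv that by simp
  qed
  have "flattening2 R *\<^sub>v v = 0\<^sub>v 9"
  proof (rule eq_vecI)
    fix r assume "r < dim_vec (0\<^sub>v 9 :: complex vec)"
    then have r: "r < 9" "r div 3 < 3" "r mod 3 < 3" by auto
    have "(flattening2 R *\<^sub>v v) $ r = y (r div 3) * (\<Sum>j<3. x (j * 3 + r mod 3) * v $ j)"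
      using v r
      by (auto simp: flattening2_def dim scalar_prod_def coeff_R sum_distrib_left mult_ac lessThan_atLeast0
          intro!: sum.cong)
    also have "\<dots> = 0" using slice[OF r(3)] i r by auto
    finally show "(flattening2 R *\<^sub>v v) $ r = 0\<^sub>v 9 $ r" using r by simp
  qed (use F2 in simp)
  then show ?thesis
    unfolding moment_of_flattening_def by (rule zero_mem_ordered_eigenvalues[OF F2 v])
qed

section \<open>The separating spectrum\<close>

lemma ordered_eigenvalues_smult_one_mat:
  "ordered_eigenvalues (complex_of_real c \<cdot>\<^sub>m 1\<^sub>m n) = replicate n c"
proof -
  let ?M = "complex_of_real c \<cdot>\<^sub>m 1\<^sub>m n"
  have "upper_triangular ?M" "diag_mat ?M = replicate n (complex_of_real c)"
    by (auto simp: diag_mat_def list_eq_iff_nth_eq)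
  then have "char_poly ?M = (\<Prod>a\<leftarrow>replicate n (complex_of_real c). [:- a, 1:])"
    using char_poly_upper_triangular[of ?M n] by simp
  then have "mset (ordered_eigenvalues ?M) = mset (replicate n c)"
    by (simp only: mset_ordered_eigenvalues) simp
  from mset_eq_length[OF this] mset_eq_setD[OF this] show ?thesis
    by (intro replicate_eqI) auto
qed

text \<open>Identity matrices fix \<open>T\<close>. Well-formedness enters because
  \<open>tensor_map\<close> is zero outside the box.\<close>

lemma tensor_mem_orbit_closure:
  assumes "wf_tensor T"
  shows "T \<in> orbit_closure T"
proof -
  have "tensor_map (1\<^sub>m (dimA T)) (1\<^sub>m (dimB T)) (1\<^sub>m (dimC T)) T = T"
  proof -
    have "coeff (tensor_map (1\<^sub>m (dimA T)) (1\<^sub>m (dimB T)) (1\<^sub>m (dimC T)) T) i j k = coeff T i j k" for i j k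
    proof (cases "i < dimA T \<and> j < dimB T \<and> k < dimC T")
      case True
      \<comment> \<open>The nested conditionals test the innermost summation variable first, so the
        sums collapse from the inside out.\<close>
      define g where "g i' j' k' =
        (if k' = k then if j' = j then if i' = i then coeff T i' j' k' else 0 else 0 else 0)" for i' j' k'
      have "coeff (tensor_map (1\<^sub>m (dimA T)) (1\<^sub>m (dimB T)) (1\<^sub>m (dimC T)) T) i j k =
          (\<Sum>i'<dimA T. \<Sum>j'<dimB T. \<Sum>k'<dimC T. g i' j' k')"
        using True by (simp add: tensor_map_def, intro sum.cong refl) (auto simp: g_def)
      also have "\<dots> = coeff T i j k"
        using True by (simp add: g_def)
      finally show ?thesis .
    next
      case False
      then show ?thesis using assms by (auto simp: tensor_map_def wf_tensor_def)
    qed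
    then show ?thesis
      by (intro tensor.expand) (auto simp: fun_eq_iff tensor_map_def)
  qed
  moreover have "1\<^sub>m n \<in> GL n" for n
    by (auto simp: GL_def invertible_mat_def inverts_mat_def intro: exI[of _ "1\<^sub>m n"])
  ultimately have "T \<in> orbit T"
    unfolding orbit_def by force
  then show ?thesis
    using closure_subset by (fastforce simp: orbit_closure_def)
qed

lemma wf_identity_slice: "wf_tensor identity_slice"
  by (auto simp: wf_tensor_def identity_slice_def split: if_splits)

text \<open>The squared norm is 3 and the Gram matrices are 3 (of size 1) and two identities of size
  3, so every moment matrix is scalar.\<close>

lemma spec_moment_map_identity_slice:
  "spec (moment_map identity_slice) = ([1], [1/3, 1/3, 1/3], [1/3, 1/3, 1/3])"
proof -
  have sum3: "sum f {0..<3::nat} = f 0 + f 1 + f 2" "sum f {..<3::nat} = f 0 + f 1 + f 2"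
    for f :: "nat \<Rightarrow> 'a::comm_monoid_add"
    by (simp_all add: numeral_3_eq_3 numeral_2_eq_2 lessThan_Suc add_ac)
  have sum9: "sum f {0..<9::nat} = f 0 + f 1 + f 2 + f 3 + f 4 + f 5 + f 6 + f 7 + f 8"
    for f :: "nat \<Rightarrow> complex"
    using sum_lessThan_9[of f] by (simp add: lessThan_atLeast0)
  have norm: "(tensor_norm identity_slice)\<^sup>2 = 3"
    by (simp add: tensor_norm_def identity_slice_def sum3)
  have less3: "i = 0 \<or> i = 1 \<or> i = 2" if "i < 3" for i :: nat
    using that by linarith
  have 1: "moment_of_flattening identity_slice (flattening1 identity_slice) = complex_of_real 1 \<cdot>\<^sub>m 1\<^sub>m 1"
    unfolding moment_of_flattening_def norm
    by (intro eq_matI) (auto simp: flattening1_def identity_slice_def scalar_prod_def sum9)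
  have 2: "moment_of_flattening identity_slice (flattening2 identity_slice) = complex_of_real (1/3) \<cdot>\<^sub>m 1\<^sub>m 3"
    unfolding moment_of_flattening_def norm
    by (intro eq_matI) (auto simp: flattening2_def identity_slice_def scalar_prod_def sum3 dest!: less3)
  have 3: "moment_of_flattening identity_slice (flattening3 identity_slice) = complex_of_real (1/3) \<cdot>\<^sub>m 1\<^sub>m 3"
    unfolding moment_of_flattening_def norm
    by (intro eq_matI) (auto simp: flattening3_def identity_slice_def scalar_prod_def sum3 dest!: less3)
  show ?thesis
    unfolding spec_def moment_map_def 1 2 3 prod.case ordered_eigenvalues_smult_one_mat
    by (simp add: numeral_3_eq_3)
qed

theorem theorem1p9:
  shows "\<exists>S T. wf_tensor S \<and> wf_tensor T \<and> nonzero_tensor S \<and> nonzero_tensor T \<and>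
           asymptotic_restriction S T \<and>
           \<not> zero_pad3 ` moment_polytope S \<subseteq> zero_pad3 ` moment_polytope T"
proof (intro exI conjI notI)
  show "wf_tensor identity_slice" by (rule wf_identity_slice)
  show "wf_tensor levi_civita" by (auto simp: wf_tensor_def levi_civita_def split: if_splits)
  have "coeff identity_slice 0 0 0 \<noteq> 0" by (simp add: identity_slice_def)
  then show nonzero: "nonzero_tensor identity_slice" unfolding nonzero_tensor_def by blast
  have "coeff levi_civita 0 1 2 \<noteq> 0" by (simp add: levi_civita_def)
  then show "nonzero_tensor levi_civita" unfolding nonzero_tensor_def by blast
  show "asymptotic_restriction identity_slice levi_civita"
    by (rule asymptotic_restriction_identity_slice)
  assume sub: "zero_pad3 ` moment_polytope identity_slice \<subseteq> zero_pad3 ` moment_polytope levi_civita"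
  have "([1], [1/3, 1/3, 1/3], [1/3, 1/3, 1/3]) \<in> moment_polytope identity_slice"
    unfolding moment_polytope_def spec_moment_map_identity_slice[symmetric]
    using nonzero tensor_mem_orbit_closure[OF wf_identity_slice] by blast
  then obtain R where R: "R \<in> orbit_closure levi_civita"
    and eq: "zero_pad3 ([1], [1/3, 1/3, 1/3], [1/3, 1/3, 1/3]) = zero_pad3 (spec (moment_map R))"
    using sub unfolding moment_polytope_def by blast
  let ?p = "ordered_eigenvalues (moment_of_flattening R (flattening1 R))"
  let ?q = "ordered_eigenvalues (moment_of_flattening R (flattening2 R))"
  have dim: "dimA R = 3" "dimB R = 3"
    using R by (auto simp: orbit_closure_def levi_civita_def)
  \<comment> \<open>With length 3, padding forces \<open>?p\<close> to be 1 followed by two zeros,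
    while \<open>?q\<close> is exactly the list of three thirds, which contains no zero.\<close>
  have len: "length ?p = 3" "length ?q = 3"
    by (auto intro!: length_ordered_eigenvalues
        simp: moment_of_flattening_def flattening1_def flattening2_def dim)
  have pad: "zero_pad ?p = zero_pad [1]" "zero_pad ?q = zero_pad [1/3, 1/3, 1/3]"
    using eq by (simp_all add: zero_pad3_def spec_def moment_map_def)
  have "?p = [1, 0, 0]"
    using zero_pad_eqD[OF pad(1)] len by (simp add: numeral_2_eq_2)
  then have "0 \<in> set ?q"
    by (rule singular_moment_orbit_closure_levi_civita[OF R])
  moreover have "?q = [1/3, 1/3, 1/3]"
    using zero_pad_eqD[OF pad(2)] len by simp
  ultimately show False
    by simp
qed

end
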